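(* Let $f$ be the quantum frieze of variables associated with $Q$. Then for any $(i,j)\in\Gamma_0$, the quantum cluster variable in $\mathcal{A}_\Sigma$ corresponding to $(i,j)$ is $$f(i,j)=\begin{cases}X_i & \text{if } j=0;\\ P_i(X_j',\dots,X_{j+i-1}') & \text{otherwise.}\end{cases}$$
   Context: Initial data. $n$ is a positive even integer. $Q$ is the quiver with vertex set $Q_0=\{1,\dots,n\}$ and arrows $i\to i+1$ for $1\le i\le n-1$ (linearly oriented Dynkin type $A_n$). $B=(b_{i,j})\in M_n(\mathbb{Z})$ has $b_{i,i+1}=1$, $b_{i,i-1}=-1$ and all other entries $0$. $\Lambda=(B^t)^{-1}=(\Lambda_{i,j})$, i.e. $\Lambda_{i,j}=1$ if $i$ is odd, $j$ is even and $i<j$; $\Lambda_{i,j}=-1$ if $i$ is even, $j$ is odd and $i>j$; $\Lambda_{i,j}=0$ otherwise. $\Lambda$ also denotes the bilinear form on $\mathbb{Z}^n$ with this matrix in the canonical basis $e_1,\dots,e_n$. Let $\nu$ be an indeterminate over $\mathbb{Z}$, $q=\nu^2$, $q^{\pm 1/2}=\nu^{\pm1}$. The based quantum torus $\mathcal{T}(\Lambda)$ is the $\mathbb{Z}[q^{\pm1/2}]$-algebra with basis $\{X^u\mid u\in\mathbb{Z}^n\}$ and product $X^uX^v=q^{\Lambda(u,v)/2}X^{u+v}$. It is an Ore domain and $\mathcal{F}(\Lambda)$ denotes its skew-field of fractions. Put $X_i=X^{e_i}$, $\mathbf{X}=(X_1,\dots,X_n)$ and $\Sigma=(B,\Lambda,\mathbf{X})$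 (the initial quantum seed). Quantum cluster variables (Berenstein--Zelevinsky). Quantum seeds are the triples $(B^*,\Lambda^*,\mathbf{Y})$ obtained from $\Sigma$ by finite sequences of mutations. For such a seed with $\mathbf{Y}=(Y_1,\dots,Y_n)$ one has $Y_iY_j=q^{\Lambda^*_{i,j}}Y_jY_i$, and one writes $Y^u=q^{-\frac12\sum_{i<j}\Lambda^*_{i,j}u_iu_j}Y_1^{u_1}\cdots Y_n^{u_n}$ for $u\in\mathbb{Z}^n$. Mutation in direction $k$ replaces $Y_k$ by $Y_k'=Y^{-e_k+\sum_i\max(b^*_{i,k},0)e_i}+Y^{-e_k+\sum_i\max(-b^*_{i,k},0)e_i}$, leaves the other $Y_i$ unchanged, replaces $B^*$ by its usual matrix mutation (entries $-b^*_{i,j}$ if $i=k$ or $j=k$, and $b^*_{i,j}+\frac12(|b^*_{i,k}|b^*_{k,j}+b^*_{i,k}|b^*_{k,j}|)$ otherwise), and replaces $\Lambda^*$ by the matrix of $q$-commutation exponents of the new cluster. The quantum cluster variables are all the elements $Y_i\in\mathcal{F}(\Lambda)$ of all clusters so obtained, and the quantum cluster algebra $\mathcal{A}_\Sigma$ is the $\mathbb{Z}[q^{\pm1/2}]$-subalgebra of $\mathcal{F}(\Lambda)$ they generate. Quantum friezes. A quantum frieze pattern on the repetition quiver $\mathbb{Z}Q$ (vertex set $Q_0\times\mathbb{Z}$) is a map $f:Q_0\times\mathbb{Z}\to\mathcal{F}(\Lambda)$ such that $$f(i,j)f(i,j+1)-q^{1/2}f(i-1,j+1)f(i+1,j)=1\quad\text{for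 all }(i,j)\in Q_0\times\mathbb{Z},$$ with the convention $f(0,j)=f(n+1,j)=1$ for all $j\in\mathbb{Z}$. The quantum frieze of variables associated with $Q$ is the unique quantum frieze pattern $f$ on $\mathbb{Z}Q$ with $f(i,0)=X_i$ for all $i\in Q_0$. $\Gamma_0=\{(i,j)\in Q_0\times\mathbb{Z}\mid j\ge0,\ i+j\le n+1\}$, which is a fundamental domain for the action of $\phi(i,j)=(n-i+1,\,j+i+1)$ on $Q_0\times\mathbb{Z}$. The map $f$ restricts to a bijection from $\Gamma_0$ to the set of quantum cluster variables of $\mathcal{A}_\Sigma$, and the quantum cluster variable corresponding to $(i,j)$ is the one given by this bijection, namely $f(i,j)$. The variables $X_i'$ and the polynomials $P_m$. For $1\le i\le n$, $X_i'$ is the quantum cluster variable obtained by mutating the initial cluster $\mathbf{X}$ in direction $i$, i.e. $X_i'=X^{-e_i+e_{i-1}}+X^{-e_i+e_{i+1}}$ with $e_0=e_{n+1}=0$. The elements $P_{m,i}=P_m(X_i',\dots,X_{i+m-1}')$ (for $m\ge0$, $i\ge1$, $m+i-1\le n$) are defined by $P_{0,i}=1$, $P_{1,i}=X_i'$ and, for $m\ge1$, $$P_{m+1,i}=\begin{cases}P_{m,i}X_{i+m}'-q^{-1/2}P_{m-1,i}&\text{if } m \text{ is even};\\ q^{-1/2}\left(P_{m,i}X_{i+m}'-P_{m-1,i}\right)&\text{if } m\text{ is odd.}\end{cases}$$ *)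

theory Defs
  imports Main
begin

text \<open>
  Matrices are functions of two indices and clusters are functions of one index; only the indices
  in {1..n} matter. Throughout, \<open>\<nu>\<close> is the square root of \<open>q\<close>, so a power of \<open>q\<close> with exponent
  \<open>a / 2\<close> is \<open>\<nu> powi a\<close>.
\<close>

definition B_mat :: "nat \<Rightarrow> nat \<Rightarrow> nat \<Rightarrow> int" where
  "B_mat n i j =
     (if i \<notin> {1..n} \<or> j \<notin> {1..n} then 0
      else if j = i + 1 then 1
      else if i = j + 1 then - 1
      else 0)"

definition Lambda_mat :: "nat \<Rightarrow> nat \<Rightarrow> nat \<Rightarrow> int" where
  "Lambda_mat n i j =
     (if i \<notin> {1..n} \<or> j \<notin> {1..n} then 0
      else if odd i \<and> even j \<and> i < j then 1
      else if even i \<and> odd j \<and> i > j then - 1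
      else 0)"

text \<open>Evenness of \<open>n\<close> is what makes \<open>Lambda_mat\<close> the inverse of the transpose of \<open>B_mat\<close>.\<close>

lemma transpose_B_mult_Lambda:
  assumes "even n" and i: "i \<in> {1..n}" and j: "j \<in> {1..n}"
  shows "(\<Sum>k = 1..n. B_mat n k i * Lambda_mat n k j) = (if i = j then 1 else 0)"
proof -
  have "(\<Sum>k = 1..n. B_mat n k i * Lambda_mat n k j) =
        (\<Sum>k = 1..n. (if k = i - 1 then Lambda_mat n k j else 0)
                      - (if k = i + 1 then Lambda_mat n k j else 0))"
    using i by (intro sum.cong) (auto simp: B_mat_def)
  also have "\<dots> = Lambda_mat n (i - 1) j - Lambda_mat n (i + 1) j"
    by (auto simp: sum_subtractf Lambda_mat_def)
  also have "\<dots> = (if i = j then 1 else 0)"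
  proof (cases "even i")
    case True
    then show ?thesis using assms
      by (cases i j rule: linorder_cases; cases "even j") (auto simp: Lambda_mat_def elim!: evenE oddE)
  next
    case False
    then have "i + 1 \<le> n" using assms by (cases "i = n") auto
    with False show ?thesis using assms
      by (cases i j rule: linorder_cases; cases "even j") (auto simp: Lambda_mat_def elim!: evenE oddE)
  qed
  finally show ?thesis .
qed

definition lattice :: "nat \<Rightarrow> (nat \<Rightarrow> int) set" where
  "lattice n = {u. \<forall>i. i \<notin> {1..n} \<longrightarrow> u i = 0}"

definition unit_vec :: "nat \<Rightarrow> nat \<Rightarrow> int" where
  "unit_vec i = (\<lambda>j. if j = i then 1 else 0)"

definition Lambda_form :: "nat \<Rightarrow> (nat \<Rightarrow> int) \<Rightarrow> (nat \<Rightarrow> int) \<Rightarrow> int" where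
  "Lambda_form n u v = (\<Sum>i = 1..n. \<Sum>j = 1..n. Lambda_mat n i j * u i * v j)"

definition laurent_ring :: "'k::division_ring \<Rightarrow> 'k set" where
  "laurent_ring \<nu> = {x. \<exists>K (c :: int \<Rightarrow> int). finite K \<and> x = (\<Sum>k\<in>K. of_int (c k) * \<nu> powi k)}"

definition quantum_torus :: "nat \<Rightarrow> 'k::division_ring \<Rightarrow> ((nat \<Rightarrow> int) \<Rightarrow> 'k) \<Rightarrow> 'k set" where
  "quantum_torus n \<nu> X =
     {x. \<exists>S c. finite S \<and> S \<subseteq> lattice n \<and> c ` S \<subseteq> laurent_ring \<nu> \<and> x = (\<Sum>u\<in>S. c u * X u)}"

text \<open>
  The type \<open>'k\<close>, with \<open>\<nu>\<close> and the family \<open>X u\<close>, is a skew-field of fractions of the based quantum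
  torus: \<open>\<nu>\<close> is central and transcendental over the integers, the \<open>X u\<close> for \<open>u\<close> in the lattice form
  a basis over the Laurent polynomials in \<open>\<nu>\<close> of a subring with the prescribed product, and every
  element is a fraction of elements of that subring. This determines the skew-field up to a unique
  isomorphism preserving \<open>\<nu>\<close> and the \<open>X u\<close>. The values \<open>X u\<close> for \<open>u\<close> outside the lattice are
  irrelevant.
\<close>

locale quantum_torus_fractions =
  fixes n :: nat
    and \<nu> :: "'k::division_ring"
    and X :: "(nat \<Rightarrow> int) \<Rightarrow> 'k"
  assumes nu_central: "\<nu> * x = x * \<nu>"
    and nu_nonzero: "\<nu> \<noteq> 0"
    and nu_transcendental:
      "\<lbrakk>finite K; (\<Sum>k\<in>K. of_int (a k) * \<nu> powi k) = 0; k \<in> K\<rbrakk> \<Longrightarrow> a k = 0"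
    and X_independent:
      "\<lbrakk>finite S; S \<subseteq> lattice n; c ` S \<subseteq> laurent_ring \<nu>; (\<Sum>u\<in>S. c u * X u) = 0; u \<in> S\<rbrakk>
        \<Longrightarrow> c u = 0"
    and X_mult:
      "\<lbrakk>u \<in> lattice n; v \<in> lattice n\<rbrakk>
        \<Longrightarrow> X u * X v = \<nu> powi Lambda_form n u v * X (\<lambda>i. u i + v i)"
    and fractions:
      "\<exists>s\<in>quantum_torus n \<nu> X. \<exists>t\<in>quantum_torus n \<nu> X. t \<noteq> 0 \<and> x = s * inverse t"

definition initial_cluster :: "((nat \<Rightarrow> int) \<Rightarrow> 'k) \<Rightarrow> nat \<Rightarrow> 'k" where
  "initial_cluster X i = X (unit_vec i)"

text \<open>The monomial \<open>Y\<^sup>u\<close>; the product is taken in the order \<open>1, \<dots>, n\<close>.\<close>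

definition cluster_monomial ::
  "nat \<Rightarrow> 'k::division_ring \<Rightarrow> (nat \<Rightarrow> nat \<Rightarrow> int) \<Rightarrow> (nat \<Rightarrow> 'k) \<Rightarrow> (nat \<Rightarrow> int) \<Rightarrow> 'k" where
  "cluster_monomial n \<nu> L Y u =
     \<nu> powi (- (\<Sum>j = 1..n. \<Sum>i = 1..<j. L i j * u i * u j)) *
     prod_list (map (\<lambda>i. Y i powi u i) [1..<Suc n])"

definition mutated_variable ::
  "nat \<Rightarrow> 'k::division_ring \<Rightarrow> (nat \<Rightarrow> nat \<Rightarrow> int) \<Rightarrow> (nat \<Rightarrow> nat \<Rightarrow> int) \<Rightarrow> (nat \<Rightarrow> 'k) \<Rightarrow> nat \<Rightarrow> 'k"
  where
  "mutated_variable n \<nu> B L Y k =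
     cluster_monomial n \<nu> L Y (\<lambda>i. max (B i k) 0 - unit_vec k i) +
     cluster_monomial n \<nu> L Y (\<lambda>i. max (- B i k) 0 - unit_vec k i)"

text \<open>The division by 2 is exact.\<close>

definition mutate_matrix :: "(nat \<Rightarrow> nat \<Rightarrow> int) \<Rightarrow> nat \<Rightarrow> nat \<Rightarrow> nat \<Rightarrow> int" where
  "mutate_matrix B k i j =
     (if i = k \<or> j = k then - B i j
      else B i j + (\<bar>B i k\<bar> * B k j + B i k * \<bar>B k j\<bar>) div 2)"

text \<open>Such a matrix is unique for a cluster of nonzero elements, since \<open>q\<close> is transcendental.\<close>

definition q_commutation_matrix ::
  "nat \<Rightarrow> 'k::division_ring \<Rightarrow> (nat \<Rightarrow> 'k) \<Rightarrow> (nat \<Rightarrow> nat \<Rightarrow> int) \<Rightarrow> bool" where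
  "q_commutation_matrix n \<nu> Y L \<longleftrightarrow>
     (\<forall>i\<in>{1..n}. \<forall>j\<in>{1..n}. Y i * Y j = (\<nu>\<^sup>2) powi L i j * (Y j * Y i)) \<and>
     (\<forall>i j. i \<notin> {1..n} \<or> j \<notin> {1..n} \<longrightarrow> L i j = 0)"

inductive quantum_seed ::
  "nat \<Rightarrow> 'k::division_ring \<Rightarrow> ((nat \<Rightarrow> int) \<Rightarrow> 'k) \<Rightarrow>
   (nat \<Rightarrow> nat \<Rightarrow> int) \<Rightarrow> (nat \<Rightarrow> nat \<Rightarrow> int) \<Rightarrow> (nat \<Rightarrow> 'k) \<Rightarrow> bool"
  for n \<nu> X where
  initial: "quantum_seed n \<nu> X (B_mat n) (Lambda_mat n) (initial_cluster X)"
| mutation: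
    "\<lbrakk>quantum_seed n \<nu> X B L Y; k \<in> {1..n};
      Y' = Y(k := mutated_variable n \<nu> B L Y k);
      q_commutation_matrix n \<nu> Y' L'\<rbrakk>
     \<Longrightarrow> quantum_seed n \<nu> X (mutate_matrix B k) L' Y'"

definition quantum_cluster_variables ::
  "nat \<Rightarrow> 'k::division_ring \<Rightarrow> ((nat \<Rightarrow> int) \<Rightarrow> 'k) \<Rightarrow> 'k set" where
  "quantum_cluster_variables n \<nu> X = {Y i | B L Y i. quantum_seed n \<nu> X B L Y \<and> i \<in> {1..n}}"

text \<open>
  A frieze is given on indices \<open>i \<in> {0..n+1}\<close> so that the boundary convention becomes a condition
  on it; its values at other indices are irrelevant.
\<close>

definition quantum_frieze :: "nat \<Rightarrow> 'k::division_ring \<Rightarrow> (nat \<times> int \<Rightarrow> 'k) \<Rightarrow> bool" where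
  "quantum_frieze n \<nu> f \<longleftrightarrow>
     (\<forall>j. f (0, j) = 1 \<and> f (n + 1, j) = 1) \<and>
     (\<forall>i\<in>{1..n}. \<forall>j. f (i, j) * f (i, j + 1) - \<nu> * f (i - 1, j + 1) * f (i + 1, j) = 1)"

definition quantum_frieze_of_variables ::
  "nat \<Rightarrow> 'k::division_ring \<Rightarrow> ((nat \<Rightarrow> int) \<Rightarrow> 'k) \<Rightarrow> (nat \<times> int \<Rightarrow> 'k) \<Rightarrow> bool" where
  "quantum_frieze_of_variables n \<nu> X f \<longleftrightarrow>
     quantum_frieze n \<nu> f \<and> (\<forall>i\<in>{1..n}. f (i, 0) = initial_cluster X i)"

definition Gamma0 :: "nat \<Rightarrow> (nat \<times> int) set" where
  "Gamma0 n = {(i, j). i \<in> {1..n} \<and> 0 \<le> j \<and> int i + j \<le> int n + 1}"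

definition X' :: "nat \<Rightarrow> 'k::division_ring \<Rightarrow> ((nat \<Rightarrow> int) \<Rightarrow> 'k) \<Rightarrow> nat \<Rightarrow> 'k" where
  "X' n \<nu> X i = mutated_variable n \<nu> (B_mat n) (Lambda_mat n) (initial_cluster X) i"

text \<open>\<open>qP \<nu> W m i\<close> is \<open>P\<^sub>m(W\<^sub>i, \<dots>, W\<^sub>i\<^sub>+\<^sub>m\<^sub>-\<^sub>1)\<close>; the recursion from \<open>m\<close> to \<open>m + 1\<close> is the
  last equation with \<open>Suc m\<close> for \<open>m\<close>.\<close>

fun qP :: "'k::division_ring \<Rightarrow> (nat \<Rightarrow> 'k) \<Rightarrow> nat \<Rightarrow> nat \<Rightarrow> 'k" where
  "qP \<nu> W 0 i = 1"
| "qP \<nu> W (Suc 0) i = W i"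
| "qP \<nu> W (Suc (Suc m)) i =
     (if even (Suc m) then qP \<nu> W (Suc m) i * W (i + Suc m) - inverse \<nu> * qP \<nu> W m i
      else inverse \<nu> * (qP \<nu> W (Suc m) i * W (i + Suc m) - qP \<nu> W m i))"

end

theory Submission
  imports Defs "HOL-Library.Function_Algebras"
begin

text \<open>
  Every entry of the frieze is an explicit Laurent polynomial with coefficients \<open>1\<close>. Put
  \<open>e\<^sub>0 = e\<^sub>n\<^sub>+\<^sub>1 = 0\<close>, let \<open>E\<^sub>l = e\<^sub>l + e\<^sub>l\<^sub>+\<^sub>1\<close>, and for \<open>0 \<le> a < b \<le> n + 1\<close> let \<open>G a b\<close> be the sum over
  \<open>a \<le> l < b\<close> of the basis elements \<open>X\<close> with exponent \<open>e\<^sub>a + e\<^sub>b - E\<^sub>l\<close>. In terms of the polygon with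
  vertices \<open>- 1, 0, \<dots>, n + 1\<close>, whose triangulations are the clusters, the initial cluster is the fan at
  \<open>- 1\<close> (\<open>X\<^sub>i\<close> is the diagonal from \<open>- 1\<close> to \<open>i\<close>), and \<open>G a b\<close> is the diagonal from \<open>a\<close> to \<open>b\<close>. The
  claim is that \<open>f (i, j) = G (j - 1) (j + i)\<close> for \<open>j > 0\<close>, and that this element is both the value of
  the polynomial \<open>P\<^sub>i\<close> and a quantum cluster variable.

  Since \<open>n\<close> is even, the form \<open>\<Lambda>\<close> is very simple on these exponents: \<open>\<Lambda>(E\<^sub>l, E\<^sub>m)\<close> is the sign of
  \<open>m - l\<close>, and \<open>\<Lambda>(E\<^sub>l, e\<^sub>b)\<close> is \<open>1\<close> or \<open>0\<close> according to whether \<open>l < b\<close> or not, minus the parity of \<open>b\<close>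
  (lemmas \<open>Lambda_edge_e\<close> and \<open>Lambda_edge_edge\<close>). Hence in a product of two elements \<open>G\<close> the power of
  \<open>\<nu>\<close> in front of the term \<open>(l, m)\<close> depends only on the order of \<open>l\<close>, \<open>m\<close> and of the ends of the two
  sums, and the identities between such products hold term by term, up to the interchange of \<open>l\<close>
  and \<open>m\<close>. Three facts follow.

  The elements \<open>G\<close> satisfy the frieze relation (\<open>frieze_relation\<close>, and \<open>frieze_relation_0\<close> for the
  first row). They are not \<open>0\<close>, because their exponents are distinct and the basis elements are
  independent, so a frieze with the given first row is determined on the fundamental domain by
  solving the relation for the one new entry (\<open>frieze_of_variables_eq\<close>).

  As \<open>G (b - 1) (b + 1)\<close> has only two terms, its product with \<open>G a b\<close> is easy to evaluate, and the result
  is the three-term recursion that defines the polynomials \<open>P\<^sub>m\<close> (\<open>frieze_entry_recursion\<close>,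
  \<open>qP_eq_frieze_entry\<close>).

  Mutating the initial seed in the directions \<open>a + 1, \<dots>, k\<close> flips the diagonals from \<open>- 1\<close> to these
  vertices, one after the other, and replaces \<open>X\<^sub>i\<close> by \<open>G a (i + 1)\<close> for \<open>a < i \<le> k\<close> (\<open>mutated_variable_fan\<close>,
  \<open>fan_seed\<close>). So every \<open>G a b\<close> with \<open>b \<ge> a + 2\<close> is a quantum cluster variable.
\<close>

section \<open>The skew-symmetric form and cluster monomials\<close>

lemma Lambda_form_add:
  "Lambda_form n (u + u') v = Lambda_form n u v + Lambda_form n u' v"
  "Lambda_form n u (v + v') = Lambda_form n u v + Lambda_form n u v'"
  by (simp_all add: Lambda_form_def algebra_simps sum.distrib)

lemma Lambda_form_uminus:
  "Lambda_form n (- u) v = - Lambda_form n u v"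
  "Lambda_form n u (- v) = - Lambda_form n u v"
  by (simp_all add: Lambda_form_def sum_negf)

lemma Lambda_form_diff:
  "Lambda_form n (u - u') v = Lambda_form n u v - Lambda_form n u' v"
  "Lambda_form n u (v - v') = Lambda_form n u v - Lambda_form n u v'"
  using Lambda_form_add[of n u "- u'"] Lambda_form_add(2)[of n u v "- v'"]
  by (simp_all add: Lambda_form_uminus)

lemma Lambda_mat_antisym: "Lambda_mat n j i = - Lambda_mat n i j"
  by (auto simp: Lambda_mat_def)

lemma Lambda_form_antisym: "Lambda_form n v u = - Lambda_form n u v"
proof -
  have "Lambda_form n v u = (\<Sum>i = 1..n. \<Sum>j = 1..n. - (Lambda_mat n j i * u j * v i))"
    unfolding Lambda_form_def
    by (intro sum.cong refl, subst Lambda_mat_antisym) (simp add: mult_ac)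
  also have "\<dots> = (\<Sum>j = 1..n. \<Sum>i = 1..n. - (Lambda_mat n j i * u j * v i))"
    by (rule sum.swap)
  finally show ?thesis by (simp add: Lambda_form_def sum_negf)
qed

lemma lattice_closed:
  "0 \<in> lattice n"
  "u \<in> lattice n \<Longrightarrow> v \<in> lattice n \<Longrightarrow> u + v \<in> lattice n"
  "u \<in> lattice n \<Longrightarrow> v \<in> lattice n \<Longrightarrow> u - v \<in> lattice n"
  by (auto simp: lattice_def)

text \<open>
  The boundary indices \<open>0\<close> and \<open>n + 1\<close> stand for the zero vector, so that the boundary values \<open>1\<close> of
  the frieze are instances of \<open>X\<close>.
\<close>

definition basis_vec :: "nat \<Rightarrow> nat \<Rightarrow> nat \<Rightarrow> int" where
  "basis_vec n i = (if i \<in> {1..n} then unit_vec i else 0)"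

text \<open>
  This is \<open>Lambda_mat\<close> without the restriction of the indices. If \<open>n\<close> is even, the parity conditions
  make it vanish when one of the two indices is \<open>0\<close> or \<open>n + 1\<close> and the other is at most \<open>n + 1\<close>.
\<close>

definition comm_exp :: "nat \<Rightarrow> nat \<Rightarrow> int" where
  "comm_exp i j = of_bool (odd i \<and> even j \<and> i < j) - of_bool (even i \<and> odd j \<and> j < i)"

lemma Lambda_form_basis_vec:
  assumes "even n" "i \<le> n + 1" "j \<le> n + 1"
  shows "Lambda_form n (basis_vec n i) (basis_vec n j) = comm_exp i j"
proof (cases "i \<in> {1..n} \<and> j \<in> {1..n}")
  case True
  have "(\<Sum>k = 1..n. c k * unit_vec m k) = c m" if "m \<in> {1..n}" for c and m :: nat
    using that by (simp add: unit_vec_def if_distrib[of "(*) x" for x] cong: if_cong)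
  from this[of j] this[of i] True
  have "Lambda_form n (unit_vec i) (unit_vec j) = Lambda_mat n i j"
    unfolding Lambda_form_def by simp
  with True show ?thesis by (auto simp: basis_vec_def comm_exp_def Lambda_mat_def)
next
  case False
  then have "Lambda_form n (basis_vec n i) (basis_vec n j) = 0"
    by (auto simp: basis_vec_def Lambda_form_def)
  moreover from False assms have "i = 0 \<or> i = n + 1 \<or> j = 0 \<or> j = n + 1" by auto
  then have "comm_exp i j = 0" using assms by (auto simp: comm_exp_def)
  ultimately show ?thesis by simp
qed

text \<open>
  The exponents of the exchange monomials below are supported on at most three indices. To treat
  all cases alike, \<open>p\<close> and \<open>s\<close> may be the boundary indices \<open>0\<close> and \<open>n + 1\<close>, where the exponent vanishes.
\<close>

lemma cluster_monomial_three:
  assumes "p < r" "r < s" "s \<le> n + 1"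
    and supp: "{i. u i \<noteq> 0} \<subseteq> {1..n} \<inter> {p, r, s}"
  shows "cluster_monomial n \<nu> L Y u =
    \<nu> powi (- (L p r * u p * u r + L p s * u p * u s + L r s * u r * u s)) *
    (Y p powi u p * Y r powi u r * Y s powi u s)"
proof -
  define S where "S = {i. u i \<noteq> 0}"
  have S: "S \<subseteq> {1..n}" "S \<subseteq> {p, r, s}" using supp by (auto simp: S_def)
  have drop: "prod_list (map (\<lambda>i. Y i powi u i) (filter (\<lambda>i. i \<in> S) xs)) =
      prod_list (map (\<lambda>i. Y i powi u i) xs)" for xs
    by (induction xs) (auto simp: S_def)
  have "filter (\<lambda>i. i \<in> S) [1..<Suc n] = filter (\<lambda>i. i \<in> S) [p, r, s]"
  proof (rule strict_sorted_equal[symmetric])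
    show "sorted_wrt (<) (filter (\<lambda>i. i \<in> S) [1..<Suc n])"
      by (intro sorted_wrt_filter) (simp del: upt_Suc)
    show "sorted_wrt (<) (filter (\<lambda>i. i \<in> S) [p, r, s])"
      using assms by (intro sorted_wrt_filter) simp
    show "set (filter (\<lambda>i. i \<in> S) [p, r, s]) = set (filter (\<lambda>i. i \<in> S) [1..<Suc n])"
      using S by auto
  qed
  then have prod: "prod_list (map (\<lambda>i. Y i powi u i) [1..<Suc n]) = Y p powi u p * Y r powi u r * Y s powi u s"
    using drop[of "[1..<Suc n]"] drop[of "[p, r, s]"] by (simp add: mult.assoc)
  have to_S: "(\<Sum>j\<in>A. \<Sum>i\<in>A \<inter> {..<j}. L i j * u i * u j) = (\<Sum>j\<in>S. \<Sum>i\<in>S \<inter> {..<j}. L i j * u i * u j)"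
    if "finite A" "S \<subseteq> A" for A
  proof (rule sum.mono_neutral_cong_right)
    fix j assume "j \<in> S"
    show "(\<Sum>i\<in>A \<inter> {..<j}. L i j * u i * u j) = (\<Sum>i\<in>S \<inter> {..<j}. L i j * u i * u j)"
      using that by (intro sum.mono_neutral_right) (auto simp: S_def)
  qed (use that in \<open>auto simp: S_def\<close>)
  have "(\<Sum>j = 1..n. \<Sum>i = 1..<j. L i j * u i * u j) =
      (\<Sum>j\<in>{1..n}. \<Sum>i\<in>{1..n} \<inter> {..<j}. L i j * u i * u j)"
    by (intro sum.cong) auto
  also have "\<dots> = (\<Sum>j\<in>{p, r, s}. \<Sum>i\<in>{p, r, s} \<inter> {..<j}. L i j * u i * u j)"
    using to_S[of "{1..n}"] to_S[of "{p, r, s}"] S by simp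
  also have "\<dots> = L p r * u p * u r + L p s * u p * u s + L r s * u r * u s"
    using assms by simp
  finally show ?thesis by (simp only: cluster_monomial_def prod)
qed

section \<open>The Laurent expansions of the frieze entries\<close>

locale even_quantum_torus = quantum_torus_fractions +
  assumes even_n: "even n"
begin

abbreviation e :: "nat \<Rightarrow> nat \<Rightarrow> int" where "e \<equiv> basis_vec n"
abbreviation \<Lambda> :: "(nat \<Rightarrow> int) \<Rightarrow> (nat \<Rightarrow> int) \<Rightarrow> int" where "\<Lambda> \<equiv> Lambda_form n"

text \<open>
  The vector \<open>E\<^sub>l\<close> belongs to the side from \<open>l\<close> to \<open>l + 1\<close> of the polygon: the term \<open>l\<close> of a
  frieze entry comes from the triangle over this side in the initial fan.
\<close>

definition edge :: "nat \<Rightarrow> nat \<Rightarrow> int" where "edge l = e l + e (l + 1)"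

definition frieze_entry :: "nat \<Rightarrow> nat \<Rightarrow> 'a" where
  "frieze_entry a b = (\<Sum>l = a..<b. X (e a + e b - edge l))"

abbreviation "G \<equiv> frieze_entry"

lemma e_lattice [simp]: "e i \<in> lattice n"
  by (auto simp: basis_vec_def lattice_def unit_vec_def)

lemma edge_lattice [simp]: "edge i \<in> lattice n"
  by (simp add: edge_def lattice_closed)

lemmas lat = lattice_closed e_lattice edge_lattice

text \<open>
  Only the one of \<open>l\<close> and \<open>l + 1\<close> whose parity is opposite to that of \<open>b\<close> can contribute. It is never
  equal to \<open>b\<close>, so it lies below \<open>b\<close> exactly if \<open>l\<close> does.
\<close>

lemma Lambda_edge_e:
  assumes "l \<le> n" "b \<le> n + 1"
  shows "\<Lambda> (edge l) (e b) = of_bool (l < b) - of_bool (odd b)"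
  using assms even_n
  by (simp add: edge_def Lambda_form_add Lambda_form_basis_vec)
     (auto simp: comm_exp_def of_bool_def; presburger)

lemma Lambda_edge_edge:
  assumes "l \<le> n" "m \<le> n"
  shows "\<Lambda> (edge l) (edge m) = of_bool (l < m) - of_bool (m < l)"
  using Lambda_edge_e[of l m] Lambda_edge_e[of l "m+1"] assms
  unfolding edge_def[of m] Lambda_form_add by auto

lemma Lambda_e_edge:
  assumes "l \<le> n" "b \<le> n + 1"
  shows "\<Lambda> (e b) (edge l) = of_bool (odd b) - of_bool (l < b)"
  using Lambda_edge_e[OF assms] by (subst Lambda_form_antisym) simp

lemma Lambda_e_e: "i \<le> n + 1 \<Longrightarrow> j \<le> n + 1 \<Longrightarrow> \<Lambda> (e i) (e j) = comm_exp i j"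
  using Lambda_form_basis_vec even_n by simp

lemmas Lambda_eval = Lambda_form_add Lambda_form_diff
  Lambda_e_e Lambda_e_edge Lambda_edge_e Lambda_edge_edge

lemma nu_pow_central: "\<nu> powi k * x = x * \<nu> powi k"
proof -
  have 1: "\<nu> ^ m * x = x * \<nu> ^ m" for m x
    by (induction m) (simp_all add: mult.assoc, metis mult.assoc nu_central)
  have "inverse \<nu> * x = x * inverse \<nu>" for x
    by (metis (no_types, opaque_lifting) mult.assoc mult.left_neutral mult.right_neutral
        left_inverse right_inverse nu_central nu_nonzero)
  then have "inverse \<nu> ^ m * x = x * inverse \<nu> ^ m" for m x
    by (induction m) (simp_all add: mult.assoc, metis mult.assoc)
  with 1 show ?thesis by (simp add: power_int_def)
qed

lemma nu_pow_left_commute: "x * (\<nu> powi k * y) = \<nu> powi k * (x * y)"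
  by (metis mult.assoc nu_pow_central)

lemma nu_pow_add_left: "\<nu> powi k * (\<nu> powi l * x) = \<nu> powi (k + l) * x"
  by (simp add: power_int_add nu_nonzero mult.assoc)

lemma nu_pow_inject: "\<nu> powi k = \<nu> powi l \<Longrightarrow> k = l"
proof (rule ccontr)
  assume *: "\<nu> powi k = \<nu> powi l" "k \<noteq> l"
  show False
    using nu_transcendental[of "{k, l}" "\<lambda>i. if i = k then 1 else - 1" k] * by simp
qed

lemma one_laurent: "1 \<in> laurent_ring \<nu>"
  unfolding laurent_ring_def by (auto intro!: exI[of _ "{0::int}"] exI[of _ "\<lambda>_. 1"])

lemma X_mult': "u \<in> lattice n \<Longrightarrow> v \<in> lattice n \<Longrightarrow> X u * X v = \<nu> powi \<Lambda> u v * X (u + v)"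
  by (simp add: X_mult plus_fun_def)

text \<open>
  Independence of the \<open>X u\<close> enters only through this fact; it makes the frieze relation solvable
  and the commutation exponents of a cluster unique.
\<close>

lemma sum_X_nonzero:
  assumes "finite S" "S \<subseteq> lattice n" "S \<noteq> {}"
  shows "(\<Sum>u\<in>S. X u) \<noteq> 0"
proof
  assume "(\<Sum>u\<in>S. X u) = 0"
  moreover obtain u where "u \<in> S" using assms by auto
  ultimately show False
    using X_independent[of S "\<lambda>_. 1" u] assms one_laurent by auto
qed

lemma X_nonzero: "u \<in> lattice n \<Longrightarrow> X u \<noteq> 0"
  using sum_X_nonzero[of "{u}"] by simp

lemma X_0: "X 0 = 1"
  using X_mult'[of 0 0] X_nonzero[of 0] by (simp add: lat Lambda_form_def)

text \<open>
  The form separates the vectors \<open>E\<^sub>l\<close>, as \<open>\<Lambda>(E\<^sub>l, E\<^sub>m)\<close> is the sign of \<open>m - l\<close>.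
\<close>

lemma inj_edge: "inj_on edge {..n}"
proof
  fix l m assume "l \<in> {..n}" "m \<in> {..n}" "edge l = edge m"
  then show "l = m"
    using Lambda_edge_edge[of l m] Lambda_edge_edge[of l l] by (cases l m rule: linorder_cases) auto
qed

lemma frieze_entry_nonzero:
  assumes "a < b" "b \<le> n + 1"
  shows "G a b \<noteq> 0"
proof -
  have "inj_on (\<lambda>l. e a + e b - edge l) {a..<b}"
    using assms inj_onD[OF inj_edge] by (intro inj_onI) auto
  then have "G a b = (\<Sum>u\<in>(\<lambda>l. e a + e b - edge l) ` {a..<b}. X u)"
    by (simp add: frieze_entry_def sum.reindex)
  also have "\<dots> \<noteq> 0"
    using assms by (intro sum_X_nonzero) (auto simp: lat)
  finally show ?thesis .
qed

text \<open>
  The products of sums of basis elements are all evaluated by this lemma and the next two. The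
  exponent of \<open>\<nu>\<close> is passed as a function \<open>\<alpha>\<close> because each application supplies it in an already
  simplified form.
\<close>

lemma sum_times_sum:
  assumes "A \<in> lattice n" "B \<in> lattice n"
    and "\<And>l m. l \<in> I \<Longrightarrow> m \<in> J \<Longrightarrow> \<Lambda> (A - edge l) (B - edge m) = \<alpha> l m"
  shows "(\<Sum>l\<in>I. X (A - edge l)) * (\<Sum>m\<in>J. X (B - edge m)) =
    (\<Sum>l\<in>I. \<Sum>m\<in>J. \<nu> powi \<alpha> l m * X (A + B - edge l - edge m))"
proof -
  have "X (A - edge l) * X (B - edge m) = \<nu> powi \<alpha> l m * X (A + B - edge l - edge m)"
    if "l \<in> I" "m \<in> J" for l m
  proof -
    have "A - edge l + (B - edge m) = A + B - edge l - edge m" by (simp add: algebra_simps)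
    from this[symmetric] show ?thesis using assms that by (simp only: X_mult' lat)
  qed
  then show ?thesis by (simp add: sum_product cong: sum.cong_simp)
qed

lemma sum_times_X:
  assumes "A \<in> lattice n" "v \<in> lattice n"
    and "\<And>l. l \<in> I \<Longrightarrow> \<Lambda> (A - edge l) v = \<alpha> l"
  shows "(\<Sum>l\<in>I. X (A - edge l)) * X v = (\<Sum>l\<in>I. \<nu> powi \<alpha> l * X (A + v - edge l))"
proof -
  have eq: "A - edge l + v = A + v - edge l" for l by (simp add: algebra_simps)
  show ?thesis using assms by (simp add: eq sum_distrib_right X_mult' lat cong: sum.cong_simp)
qed

lemma X_times_sum:
  assumes "A \<in> lattice n" "v \<in> lattice n"
    and "\<And>l. l \<in> I \<Longrightarrow> \<Lambda> v (A - edge l) = \<alpha> l"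
  shows "X v * (\<Sum>l\<in>I. X (A - edge l)) = (\<Sum>l\<in>I. \<nu> powi \<alpha> l * X (A + v - edge l))"
proof -
  have eq: "v + (A - edge l) = A + v - edge l" for l by (simp add: algebra_simps)
  show ?thesis using assms by (simp add: eq sum_distrib_left X_mult' lat cong: sum.cong_simp)
qed

lemma frieze_entry_1: "G a (a + 1) = 1"
  by (simp add: frieze_entry_def edge_def X_0)

text \<open>
  The power of \<open>\<nu>\<close> in the product of \<open>G a b\<close> and \<open>X\<^sub>i\<close> when the two diagonals do not cross, that is,
  when \<open>i\<close> does not lie strictly between \<open>a\<close> and \<open>b\<close>. It is the same for all terms of \<open>G a b\<close>, and this
  is why the two elements \<open>q\<close>-commute.
\<close>

definition pair_exp :: "nat \<Rightarrow> nat \<Rightarrow> nat \<Rightarrow> int" where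
  "pair_exp a b i = comm_exp a i + comm_exp b i - of_bool (a < i) + of_bool (odd i)"

lemma Lambda_pair_exp:
  assumes "a < b" "b \<le> n + 1" "i \<le> n + 1" "i \<le> a \<or> b \<le> i" "a \<le> l" "l < b"
  shows "\<Lambda> (e a + e b - edge l) (e i) = pair_exp a b i"
  using assms by (auto simp: Lambda_eval pair_exp_def)

lemma frieze_entry_X_commute:
  assumes "a < b" "b \<le> n + 1" "i \<le> n + 1" "i \<le> a \<or> b \<le> i"
  shows "G a b * X (e i) = \<nu> powi (2 * pair_exp a b i) * (X (e i) * G a b)"
proof -
  note * = Lambda_pair_exp[OF assms]
  have **: "\<Lambda> (e i) (e a + e b - edge l) = - pair_exp a b i" if "a \<le> l" "l < b" for l
    using that * by (subst Lambda_form_antisym) simp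
  have "G a b * X (e i) = \<nu> powi pair_exp a b i * (\<Sum>l = a..<b. X (e a + e b + e i - edge l))"
    unfolding frieze_entry_def
    by (subst sum_times_X[where \<alpha> = "\<lambda>_. pair_exp a b i"]) (simp_all add: lat * sum_distrib_left)
  moreover have "X (e i) * G a b = \<nu> powi (- pair_exp a b i) * (\<Sum>l = a..<b. X (e a + e b + e i - edge l))"
    unfolding frieze_entry_def
    by (subst X_times_sum[where \<alpha> = "\<lambda>_. - pair_exp a b i"]) (simp_all add: lat ** sum_distrib_left)
  ultimately show ?thesis by (simp add: nu_pow_add_left)
qed

section \<open>The frieze relation and the recursion\<close>

text \<open>
  Both products are sums of the same symmetric family \<open>T l m\<close>, the first one over \<open>a \<le> l < b\<close> and
  \<open>a < m \<le> b\<close>, the second one over \<open>a < l < b\<close> and \<open>a \<le> m \<le> b\<close>. The term \<open>T a b = 1\<close> occurs only in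
  the first one and gives the right-hand side. All other terms cancel against \<open>\<nu>\<close> times the
  second product, with \<open>T a m\<close> in the first
  product matched with \<open>T m a\<close> in the second one.
\<close>

lemma frieze_relation:
  assumes "a < b" "b \<le> n"
  shows "G a b * G (a + 1) (b + 1) - \<nu> * G (a + 1) b * G a (b + 1) = 1"
proof -
  define T where "T l m = X (e a + e b + (e (a + 1) + e (b + 1)) - edge l - edge m)" for l m
  define I where "I = {a + 1..<b}"
  define s where "s l m = (of_bool (l < m) - of_bool (m < l) :: int)" for l m :: nat
  have T_sym: "T l m = T m l" for l m by (simp add: T_def algebra_simps)
  have I: "{a..<b} = insert a I" "{a + 1..<b + 1} = insert b I" "{a..<b + 1} = insert a (insert b I)"
    "a \<notin> I" "b \<notin> I" "finite I" "a \<noteq> b" "\<not> b < a"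
    using assms by (auto simp: I_def)
  have I_less: "\<And>m. m \<in> I \<Longrightarrow> a < m \<and> m < b \<and> m \<noteq> a \<and> m \<noteq> b \<and> \<not> b < m \<and> \<not> m < a" by (auto simp: I_def)
  have T_ab: "T a b = 1" by (simp add: T_def edge_def algebra_simps X_0)
  have perm: "e (a + 1) + e b + (e a + e (b + 1)) = e a + e b + (e (a + 1) + e (b + 1))"
    by (simp add: algebra_simps)
  have exp1: "\<Lambda> (e a + e b - edge l) (e (a + 1) + e (b + 1) - edge m)
      = of_bool (m < b) - of_bool (l = a) + s l m"
    if "l \<in> {a..<b}" "m \<in> {a + 1..<b + 1}" for l m
    using that assms by (simp add: Lambda_eval s_def) (auto simp: comm_exp_def of_bool_def; presburger)
  have exp2: "\<Lambda> (e (a + 1) + e b - edge l) (e a + e (b + 1) - edge m)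
      = of_bool (m = a) + of_bool (m < b) - 1 + s l m"
    if "l \<in> I" "m \<in> {a..<b + 1}" for l m
    using that assms by (simp add: Lambda_eval s_def I_def) (auto simp: comm_exp_def of_bool_def; presburger)
  have "G a b * G (a + 1) (b + 1) =
      (\<Sum>l = a..<b. \<Sum>m = a + 1..<b + 1. \<nu> powi (of_bool (m < b) - of_bool (l = a) + s l m) * T l m)"
    unfolding frieze_entry_def T_def by (rule sum_times_sum) (use exp1 in \<open>simp_all add: lat\<close>)
  also have "\<dots> = 1 + (\<Sum>m\<in>I. \<nu> * T a m) +
     (\<Sum>l\<in>I. \<nu> * T l b + (\<Sum>m\<in>I. \<nu> powi (1 + s l m) * T l m))"
    using I T_ab by (simp add: I_less s_def sum.distrib assms cong: sum.cong_simp)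
  finally have 1: "G a b * G (a + 1) (b + 1) = \<dots>" .
  have "G (a + 1) b * G a (b + 1) =
      (\<Sum>l\<in>I. \<Sum>m = a..<b + 1. \<nu> powi (of_bool (m = a) + of_bool (m < b) - 1 + s l m) * T l m)"
    unfolding frieze_entry_def T_def I_def[symmetric] perm[symmetric]
    by (rule sum_times_sum) (use exp2 in \<open>simp_all add: lat\<close>)
  also have "\<dots> = (\<Sum>l\<in>I. T l a + T l b + (\<Sum>m\<in>I. \<nu> powi (s l m) * T l m))"
    using I by (simp add: I_less s_def sum.distrib assms add.assoc cong: sum.cong_simp)
  finally have 2: "G (a + 1) b * G a (b + 1) = \<dots>" .
  have "\<nu> * G (a + 1) b * G a (b + 1) =
     (\<Sum>m\<in>I. \<nu> * T a m) + (\<Sum>l\<in>I. \<nu> * T l b + (\<Sum>m\<in>I. \<nu> powi (1 + s l m) * T l m))"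
    unfolding mult.assoc 2
    by (simp add: sum.distrib sum_distrib_left distrib_left power_int_add nu_nonzero mult.assoc T_sym[of a])
  with 1 show ?thesis by (simp only:) simp
qed

text \<open>
  The relation on the first row is the case of the diagonals that start at the vertex \<open>- 1\<close>; the
  only term of \<open>G 0 (i + 1)\<close> without a partner in \<open>G 0 i\<close> is \<open>l = i\<close>, and it gives \<open>1\<close>.
\<close>

lemma frieze_relation_0:
  assumes "0 < i" "i \<le> n"
  shows "X (e i) * G 0 (i + 1) - \<nu> * G 0 i * X (e (i + 1)) = 1"
proof -
  have e0: "e 0 = 0" by (simp add: basis_vec_def)
  have exp1: "\<Lambda> (e i) (e (i + 1) - edge l) = of_bool (l < i)" if "l < Suc i" for l
    using that assms by (simp add: Lambda_eval) (auto simp: comm_exp_def of_bool_def)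
  have exp2: "\<Lambda> (e i - edge l) (e (i + 1)) = 0" if "l < i" for l
    using that assms by (simp add: Lambda_eval) (auto simp: comm_exp_def of_bool_def)
  have "X (e i) * G 0 (i + 1) =
      (\<Sum>l<Suc i. \<nu> powi of_bool (l < i) * X (e (i + 1) + e i - edge l))"
    using X_times_sum[of "e (i + 1)" "e i" "{..<Suc i}", OF _ _ exp1]
    by (simp add: frieze_entry_def e0 lat atLeast0LessThan del: sum.lessThan_Suc)
  also have "\<dots> = 1 + \<nu> * (\<Sum>l<i. X (e i + e (i + 1) - edge l))"
    by (simp add: sum_distrib_left X_0 edge_def add.commute)
  also have "(\<Sum>l<i. X (e i + e (i + 1) - edge l)) = G 0 i * X (e (i + 1))"
    using sum_times_X[of "e i" "e (i + 1)" "{..<i}", OF _ _ exp2]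
    by (simp add: frieze_entry_def e0 lat atLeast0LessThan)
  finally show ?thesis by (simp add: mult.assoc)
qed

text \<open>
  The two terms of \<open>G (b - 1) (b + 1)\<close> move the end \<open>b\<close> of the diagonal to \<open>b + 1\<close> and to \<open>b - 1\<close>. The
  first one yields all terms of \<open>G a (b + 1)\<close> except \<open>l = b\<close>. The second one yields \<open>G a (b - 1)\<close>, and
  from \<open>l = b - 1\<close> the missing term. The powers of \<open>\<nu>\<close> depend only on the parity of \<open>b - a\<close>.
\<close>

lemma frieze_entry_recursion:
  assumes "a < b" "b \<le> n"
  shows "G a b * G (b - 1) (b + 1) = 
    (if even (b - a) then \<nu> * G a (b + 1) + G a (b - 1) else G a (b + 1) + inverse \<nu> * G a (b - 1))"
proof -
  define p :: int where "p = of_bool (even (b - a))"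
  obtain c where c: "b = Suc c" using assms by (cases b) auto
  have par: "even (b - a) \<longleftrightarrow> (even a \<longleftrightarrow> even b)" using assms by auto
  have exp1: "\<Lambda> (e a + e b - edge l) (e (b + 1) - e b) = p" if "l \<in> {a..<b}" for l
    using that assms unfolding p_def par
    by (simp add: Lambda_eval) (auto simp: comm_exp_def of_bool_def; presburger)
  have exp2: "\<Lambda> (e a + e b - edge l) (e c - e b) = of_bool (l = c) + p - 1" if "l \<in> {a..<b}" for l
    using that assms unfolding p_def par
    by (simp add: Lambda_eval c) (auto simp: comm_exp_def of_bool_def c; presburger)
  have W: "G c (Suc (Suc c)) = X (e (Suc (Suc c)) - e (Suc c)) + X (e c - e (Suc c))"
    by (simp add: frieze_entry_def edge_def algebra_simps)
  have shift: "e a + e b + (v - e b) - edge l = e a + v - edge l" for v l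
    by (simp add: algebra_simps)
  have "G a b * X (e (b + 1) - e b) = \<nu> powi p * (\<Sum>l = a..<b. X (e a + e (b + 1) - edge l))"
    using sum_times_X[of "e a + e b" "e (b + 1) - e b" "{a..<b}", OF _ _ exp1]
    by (simp only: frieze_entry_def sum_distrib_left shift lat)
  moreover have "G a b * X (e c - e b) =
      (\<Sum>l = a..<b. \<nu> powi (of_bool (l = c) + p - 1) * X (e a + e c - edge l))"
    using sum_times_X[of "e a + e b" "e c - e b" "{a..<b}", OF _ _ exp2]
    by (simp only: frieze_entry_def shift lat)
  moreover have "\<dots> = \<nu> powi p * X (e a + e (b + 1) - edge b) + \<nu> powi (p - 1) * G a c"
    using assms by (simp add: c frieze_entry_def sum_distrib_left edge_def algebra_simps cong: sum.cong_simp)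
  ultimately have "G a b * G (b - 1) (b + 1) = \<nu> powi p * G a (b + 1) + \<nu> powi (p - 1) * G a (b - 1)"
    using assms by (simp add: W distrib_left c frieze_entry_def[of a "Suc (Suc c)"] add.assoc)
  then show ?thesis by (simp add: p_def)
qed

text \<open>
  Interchanging the factors changes the power of \<open>\<nu>\<close> at \<open>(l, m)\<close> by an amount that depends on the
  sign of \<open>m - l\<close>. This sign is constant for \<open>m \<ge> b\<close>, and for \<open>m < b\<close> it is compensated by
  the interchange of \<open>l\<close> and \<open>m\<close>.
\<close>

lemma frieze_entries_commute:
  assumes "a < b" "b \<le> c" "c \<le> n + 1"
  shows "\<exists>k. G a b * G a c = \<nu> powi (2 * k) * (G a c * G a b)"
proof -
  define T where "T l m = X (e a + e b + (e a + e c) - edge l - edge m)" for l m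
  define s where "s l m = (of_bool (l < m) - of_bool (m < l) :: int)" for l m :: nat
  define k where "k = comm_exp b a + comm_exp a c + comm_exp b c + of_bool (odd c) - of_bool (odd b) - 1"
  have T_sym: "T l m = T m l" for l m by (simp add: T_def algebra_simps)
  have T_perm: "T l m = X (e a + e c + (e a + e b) - edge m - edge l)" for l m
    by (simp add: T_def algebra_simps)
  have split: "(\<Sum>m = a..<c. h m) = (\<Sum>m = a..<b. h m) + (\<Sum>m = b..<c. h m)" for h :: "nat \<Rightarrow> 'a"
    using assms by (simp add: sum.atLeastLessThan_concat)
  have exp1: "\<Lambda> (e a + e b - edge l) (e a + e c - edge m) = k + of_bool (m < b) + s l m"
    if "l \<in> {a..<b}" "m \<in> {a..<c}" for l m
    using that assms by (simp add: Lambda_eval s_def k_def) (auto simp: comm_exp_def of_bool_def)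
  then have exp2: "\<Lambda> (e a + e c - edge m) (e a + e b - edge l) = - k - of_bool (m < b) - s l m"
    if "l \<in> {a..<b}" "m \<in> {a..<c}" for l m
    using that by (subst Lambda_form_antisym) simp
  have "G a b * G a c = (\<Sum>l = a..<b. \<Sum>m = a..<c. \<nu> powi (k + of_bool (m < b) + s l m) * T l m)"
    unfolding frieze_entry_def T_def by (rule sum_times_sum) (use exp1 in \<open>simp_all add: lat\<close>)
  also have "\<dots> = (\<Sum>l = a..<b. \<Sum>m = a..<b. \<nu> powi (k + 1 + s l m) * T l m) +
      (\<Sum>l = a..<b. \<Sum>m = b..<c. \<nu> powi (k + 1) * T l m)"
    unfolding split sum.distrib by (simp add: s_def cong: sum.cong_simp)
  finally have 1: "G a b * G a c = \<dots>" .
  have "G a c * G a b = (\<Sum>m = a..<c. \<Sum>l = a..<b. \<nu> powi (- k - of_bool (m < b) - s l m) * T l m)"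
    unfolding frieze_entry_def T_perm by (rule sum_times_sum) (use exp2 in \<open>simp_all add: lat\<close>)
  also have "\<dots> = (\<Sum>m = a..<b. \<Sum>l = a..<b. \<nu> powi (- k - 1 + s m l) * T m l) +
      (\<Sum>m = b..<c. \<Sum>l = a..<b. \<nu> powi (- k - 1) * T l m)"
    unfolding split using T_sym by (simp add: s_def algebra_simps cong: sum.cong_simp)
  also have "(\<Sum>m = b..<c. \<Sum>l = a..<b. \<nu> powi (- k - 1) * T l m) =
      (\<Sum>l = a..<b. \<Sum>m = b..<c. \<nu> powi (- k - 1) * T l m)"
    by (rule sum.swap)
  finally have "\<nu> powi (2 * (k + 1)) * (G a c * G a b) = G a b * G a c"
    by (simp add: 1 distrib_left sum_distrib_left nu_pow_add_left algebra_simps)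
  then show ?thesis by metis
qed

section \<open>Mutations of the initial seed\<close>

lemma nu_sq_pow: "(\<nu>\<^sup>2) powi k = \<nu> powi (2 * k)"
  by (simp add: power_int_power)

text \<open>
  A seed may carry any matrix that records the commutation of its cluster. Since \<open>\<nu>\<close> is
  transcendental, its entries can be read off from the commutation relations of the cluster.
\<close>

lemma q_commutation_exponent:
  assumes "q_commutation_matrix n \<nu> Y L" "i \<in> {1..n}" "j \<in> {1..n}" "Y i \<noteq> 0" "Y j \<noteq> 0"
    and "Y i * Y j = \<nu> powi (2 * k) * (Y j * Y i)"
  shows "L i j = k"
proof -
  have "Y i * Y j = \<nu> powi (2 * L i j) * (Y j * Y i)"
    using assms(1-3) unfolding q_commutation_matrix_def nu_sq_pow by blast
  then have "\<nu> powi (2 * L i j) * (Y j * Y i) = \<nu> powi (2 * k) * (Y j * Y i)"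
    using assms(6) by metis
  then have "\<nu> powi (2 * L i j) = \<nu> powi (2 * k)" using assms(4,5) by simp
  then show ?thesis using nu_pow_inject by fastforce
qed

lemma initial_cluster_eq: "i \<in> {1..n} \<Longrightarrow> initial_cluster X i = X (e i)"
  by (simp add: initial_cluster_def basis_vec_def)

lemma X_e_commute:
  assumes "i \<le> n + 1" "j \<le> n + 1"
  shows "X (e i) * X (e j) = \<nu> powi (2 * comm_exp i j) * (X (e j) * X (e i))"
proof -
  have "comm_exp j i = - comm_exp i j" by (simp add: comm_exp_def)
  then show ?thesis using assms by (simp add: X_mult' lat Lambda_e_e nu_pow_add_left add.commute)
qed

lemma initial_q_commutation: "q_commutation_matrix n \<nu> (initial_cluster X) (Lambda_mat n)"
proof -
  have "comm_exp i j = Lambda_mat n i j" if "i \<in> {1..n}" "j \<in> {1..n}" for i j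
    using that by (auto simp: comm_exp_def Lambda_mat_def)
  then have "initial_cluster X i * initial_cluster X j =
      (\<nu>\<^sup>2) powi Lambda_mat n i j * (initial_cluster X j * initial_cluster X i)"
    if "i \<in> {1..n}" "j \<in> {1..n}" for i j
    using that X_e_commute[of i j] by (simp add: initial_cluster_eq nu_sq_pow)
  moreover have "Lambda_mat n i j = 0" if "i \<notin> {1..n} \<or> j \<notin> {1..n}" for i j
    using that by (auto simp: Lambda_mat_def)
  ultimately show ?thesis
    unfolding q_commutation_matrix_def by blast
qed

lemma quantum_seed_q_commutation:
  assumes "quantum_seed n \<nu> X B L Y"
  shows "q_commutation_matrix n \<nu> Y L"
  using assms by cases (auto simp: initial_q_commutation)

text \<open>
  The cluster after the mutations in the directions \<open>a + 1, \<dots>, k\<close>: the diagonals from \<open>- 1\<close> to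
  \<open>a + 1, \<dots>, k\<close> have been replaced by those from \<open>a\<close> to \<open>a + 2, \<dots>, k + 1\<close>.
\<close>

definition fan_cluster :: "nat \<Rightarrow> nat \<Rightarrow> nat \<Rightarrow> 'a" where
  "fan_cluster a k i = (if a < i \<and> i \<le> k then G a (i + 1) else initial_cluster X i)"

lemma fan_cluster_nonzero:
  assumes "k \<le> n" "i \<in> {1..n}"
  shows "fan_cluster a k i \<noteq> 0"
  using assms frieze_entry_nonzero[of a "i + 1"] by (simp add: fan_cluster_def initial_cluster_eq X_nonzero)

lemma fan_cluster_commute:
  assumes "k \<le> n" "i \<in> {1..n}" "j \<in> {1..n}"
  shows "\<exists>c. fan_cluster a k i * fan_cluster a k j = (\<nu>\<^sup>2) powi c * (fan_cluster a k j * fan_cluster a k i)"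
proof -
  define qc where "qc x y \<longleftrightarrow> (\<exists>c. x * y = \<nu> powi (2 * c) * (y * x))" for x y
  have sym: "qc x y \<Longrightarrow> qc y x" for x y
  proof -
    assume "qc x y"
    then obtain c where "x * y = \<nu> powi (2 * c) * (y * x)" by (auto simp: qc_def)
    then have "y * x = \<nu> powi (2 * (- c)) * (x * y)" by (simp add: nu_pow_add_left)
    then show "qc y x" unfolding qc_def by blast
  qed
  have XX: "qc (X (e i)) (X (e j))" if "i \<in> {1..n}" "j \<in> {1..n}" for i j
    unfolding qc_def using that X_e_commute[of i j] by auto
  have GX: "qc (G a (i + 1)) (X (e j))" if "a < i" "i \<le> k" "j \<in> {1..n}" "\<not> (a < j \<and> j \<le> k)" for i j
    unfolding qc_def using that assms frieze_entry_X_commute[of a "i + 1" j] by auto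
  have GG: "qc (G a (i + 1)) (G a (j + 1))" if "a < i" "i \<le> k" "a < j" "j \<le> k" for i j
  proof (cases "i \<le> j")
    case True
    then show ?thesis
      unfolding qc_def using that assms by (intro frieze_entries_commute) auto
  next
    case False
    then have "qc (G a (j + 1)) (G a (i + 1))"
      unfolding qc_def using that assms by (intro frieze_entries_commute) auto
    then show ?thesis by (rule sym)
  qed
  have "qc (fan_cluster a k i) (fan_cluster a k j)"
    using assms XX[of i j] GX[of i j] sym[OF GX[of j i]] GG[of i j]
    by (auto simp: fan_cluster_def initial_cluster_eq)
  then show ?thesis by (auto simp: qc_def nu_sq_pow)
qed

lemma fan_cluster_q_commutation_matrix:
  assumes "k \<le> n"
  shows "\<exists>L. q_commutation_matrix n \<nu> (fan_cluster a k) L"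
proof -
  define L where "L i j = (if i \<in> {1..n} \<and> j \<in> {1..n}
    then SOME c. fan_cluster a k i * fan_cluster a k j = (\<nu>\<^sup>2) powi c * (fan_cluster a k j * fan_cluster a k i)
    else 0)" for i j
  have "fan_cluster a k i * fan_cluster a k j = (\<nu>\<^sup>2) powi L i j * (fan_cluster a k j * fan_cluster a k i)"
    if "i \<in> {1..n}" "j \<in> {1..n}" for i j
    using someI_ex[OF fan_cluster_commute[OF assms that]] that by (simp only: L_def if_True simp_thms)
  moreover have "L i j = 0" if "i \<notin> {1..n} \<or> j \<notin> {1..n}" for i j
    using that by (auto simp: L_def)
  ultimately show ?thesis
    unfolding q_commutation_matrix_def by blast
qed

text \<open>
  The column \<open>k + 1\<close> of the exchange matrix after the mutations in the directions \<open>a + 1, \<dots>, k\<close>. The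
  case \<open>i = a\<close> precedes the case \<open>i = k\<close>, so that \<open>k = a\<close> gives the column \<open>a + 1\<close> of the initial
  matrix.
\<close>

definition fan_column :: "nat \<Rightarrow> nat \<Rightarrow> nat \<Rightarrow> int" where
  "fan_column a k i =
    (if i \<notin> {1..n} then 0 else if i = a then 1 else if i = k \<or> i = k + 2 then - 1 else 0)"

text \<open>
  The diagonal from \<open>- 1\<close> to \<open>k + 1\<close> is flipped in the quadrilateral \<open>- 1, a, k + 1, k + 2\<close>. One of the
  two monomials is the term \<open>l = k + 1\<close> of \<open>G a (k + 2)\<close>. The other one is
  \<open>G a (k + 1) X\<^sub>k\<^sub>+\<^sub>1\<^sup>-\<^sup>1 X\<^sub>k\<^sub>+\<^sub>2\<close> up to a power of \<open>\<nu>\<close>, and gives all other terms; its normalization cancels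
  the power of \<open>\<nu>\<close> that the product produces, since this power is the same for all terms of
  \<open>G a (k + 1)\<close>.
\<close>

lemma mutated_variable_fan:
  assumes "a \<le> k" "k < n"
    and L: "q_commutation_matrix n \<nu> (fan_cluster a k) L"
    and B: "\<And>i. B i (k + 1) = fan_column a k i"
  shows "mutated_variable n \<nu> B L (fan_cluster a k) (k + 1) = G a (k + 2)"
proof -
  define Y where "Y = fan_cluster a k"
  define c where "c = k + 1"
  define r where "r = k + 2"
  have ord: "a < c" "k < c" "c < r" "r \<le> n + 1" "c \<in> {1..n}" "a \<le> n" "a \<noteq> r"
    using assms by (auto simp: c_def r_def)
  define up where "up = (\<lambda>i. max (B i c) 0 - unit_vec c i)"
  define um where "um = (\<lambda>i. max (- B i c) 0 - unit_vec c i)"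
  have up: "up i = of_bool (i = a \<and> 0 < a) - of_bool (i = c)" for i
    using ord B by (auto simp: up_def c_def fan_column_def unit_vec_def)
  have um: "um i = of_bool (i = k \<and> a < k) + of_bool (i = r \<and> r \<le> n) - of_bool (i = c)" for i
    using ord B assms by (auto simp: um_def c_def r_def fan_column_def unit_vec_def)
  have Y_nz: "Y i \<noteq> 0" if "i \<in> {1..n}" for i
    using that fan_cluster_nonzero assms by (simp add: Y_def)
  have Y_X: "Y i = X (e i)" if "i \<in> {1..n}" "i \<le> a \<or> k < i" for i
    using that by (auto simp: Y_def fan_cluster_def initial_cluster_eq)
  note L_eq = q_commutation_exponent[OF L[folded Y_def]]
  have comm_exp_self: "comm_exp i i = 0" for i by (simp add: comm_exp_def)
  have X_inv: "X (e a) * inverse (X (e c)) = \<nu> powi (- comm_exp a c) * X (e a - e c)"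
  proof -
    have "X (e a - e c) * X (e c) = \<nu> powi comm_exp a c * X (e a)"
      using X_mult'[of "e a - e c" "e c"] ord by (simp add: lat Lambda_form_diff Lambda_e_e comm_exp_self)
    then have "X (e a) = \<nu> powi (- comm_exp a c) * (X (e a - e c) * X (e c))"
      by (simp add: nu_pow_add_left)
    then show ?thesis by (simp add: mult.assoc X_nonzero)
  qed
  have inv_X: "inverse (X (e c)) * X (e r) = \<nu> powi (- comm_exp c r) * X (e r - e c)"
  proof -
    have "X (e c) * X (e r - e c) = \<nu> powi comm_exp c r * X (e r)"
      using X_mult'[of "e c" "e r - e c"] ord by (simp add: lat Lambda_form_diff Lambda_e_e comm_exp_self)
    then have "X (e r) = \<nu> powi (- comm_exp c r) * (X (e c) * X (e r - e c))"
      by (simp add: nu_pow_add_left)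
    then have "inverse (X (e c)) * X (e r) =
        \<nu> powi (- comm_exp c r) * (inverse (X (e c)) * X (e c) * X (e r - e c))"
      by (simp only: nu_pow_left_commute mult.assoc)
    then show ?thesis by (simp add: X_nonzero)
  qed
  have L_XX: "L i j = comm_exp i j" if "i \<in> {1..n}" "j \<in> {1..n}" "i \<le> a \<or> k < i" "j \<le> a \<or> k < j" for i j
    using that Y_X X_e_commute[of i j] by (intro L_eq) (auto simp: X_nonzero)
  have "cluster_monomial n \<nu> L Y up = X (e a - e c)"
  proof -
    have "cluster_monomial n \<nu> L Y up =
        \<nu> powi (- (L a c * up a * up c + L a r * up a * up r + L c r * up c * up r)) *
        (Y a powi up a * Y c powi up c * Y r powi up r)"
      using ord by (intro cluster_monomial_three) (auto simp: up)
    also have "\<dots> = \<nu> powi (L a c * of_bool (0 < a)) * (Y a powi of_bool (0 < a) * inverse (X (e c)))"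
      using ord by (simp add: up Y_X)
    also have "L a c * of_bool (0 < a) = comm_exp a c"
      using ord L_XX[of a c] by (auto simp: comm_exp_def)
    also have "Y a powi of_bool (0 < a) = X (e a)"
      using ord by (cases "a = 0") (auto simp: Y_X basis_vec_def X_0)
    finally show ?thesis
      by (simp add: X_inv nu_pow_add_left)
  qed
  moreover have "cluster_monomial n \<nu> L Y um = (\<Sum>l = a..<c. X (e a + e r - edge l))"
  proof -
    \<comment> \<open>For \<open>k = a\<close> the factor \<open>G a (k + 1)\<close> is the side \<open>1\<close> and not an element of the cluster; both
      sides are then \<open>0\<close>.\<close>
    have L_k: "L k i * of_bool (a < k) = pair_exp a c i" if "i = c \<or> i = r" "i \<le> n" for i
    proof (cases "a < k")
      case True
      then have "Y k = G a c" using assms by (simp add: Y_def fan_cluster_def c_def)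
      then show ?thesis
        using True that ord assms frieze_entry_X_commute[of a c i] Y_nz
        by (simp, intro L_eq) (auto simp: Y_X X_nonzero)
    next
      case False
      with assms have "k = a" by simp
      with that show ?thesis
        by (auto simp: pair_exp_def comm_exp_def of_bool_def c_def r_def)
    qed
    \<comment> \<open>For \<open>k + 2 = n + 1\<close> the factor \<open>X\<^sub>k\<^sub>+\<^sub>2\<close> is \<open>1\<close>, and its exponents vanish because \<open>n + 1\<close> is odd.\<close>
    have r_out: "r = n + 1" if "\<not> r \<le> n" using that ord by simp
    have pair_r: "L k r * of_bool (a < k) * of_bool (r \<le> n) = pair_exp a c r"
    proof (cases "r \<le> n")
      case True
      then show ?thesis using L_k[of r] by simp
    next
      case False
      then have "odd r" "n < r" using r_out even_n by auto
      then show ?thesis using False ord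
        by (simp add: pair_exp_def comm_exp_def)
    qed
    have L_cr: "L c r * of_bool (r \<le> n) = comm_exp c r"
    proof (cases "r \<le> n")
      case True
      then show ?thesis using L_XX[of c r] ord by (simp add: c_def r_def)
    next
      case False
      then have "odd r" using r_out even_n by auto
      then show ?thesis using False ord by (simp add: comm_exp_def)
    qed
    have "cluster_monomial n \<nu> L Y um =
        \<nu> powi (- (L k c * um k * um c + L k r * um k * um r + L c r * um c * um r)) *
        (Y k powi um k * Y c powi um c * Y r powi um r)"
      using ord by (intro cluster_monomial_three) (auto simp: um)
    also have "\<dots> = \<nu> powi (L k c * of_bool (a < k) - L k r * of_bool (a < k) * of_bool (r \<le> n) + L c r * of_bool (r \<le> n)) *
        (Y k powi of_bool (a < k) * (inverse (X (e c)) * Y r powi of_bool (r \<le> n)))"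
      using ord by (simp add: um Y_X algebra_simps)
    also have "Y k powi of_bool (a < k) = G a c"
      using assms frieze_entry_1[of a] by (auto simp: Y_def fan_cluster_def c_def)
    also have "Y r powi of_bool (r \<le> n) = X (e r)"
    proof (cases "r \<le> n")
      case True
      then show ?thesis using ord Y_X[of r] by simp
    next
      case False
      then show ?thesis by (simp add: r_out basis_vec_def X_0)
    qed
    also note inv_X
    also have "G a c * (\<nu> powi (- comm_exp c r) * X (e r - e c)) =
        \<nu> powi (- comm_exp c r + pair_exp a c r - pair_exp a c c) * (\<Sum>l = a..<c. X (e a + e r - edge l))"
    proof -
      have "\<Lambda> (e a + e c - edge l) (e r - e c) = pair_exp a c r - pair_exp a c c" if "l \<in> {a..<c}" for l
        using that ord by (simp add: Lambda_form_diff(2)[of n _ "e r"] Lambda_pair_exp)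
      from sum_times_X[of "e a + e c" "e r - e c" "{a..<c}", OF _ _ this]
      have "G a c * X (e r - e c) =
          \<nu> powi (pair_exp a c r - pair_exp a c c) * (\<Sum>l = a..<c. X (e a + e c + (e r - e c) - edge l))"
        by (simp only: frieze_entry_def sum_distrib_left lat)
      also have "e a + e c + (e r - e c) = e a + e r" by simp
      finally have eq: "G a c * X (e r - e c) =
          \<nu> powi (pair_exp a c r - pair_exp a c c) * (\<Sum>l = a..<c. X (e a + e r - edge l))" .
      show ?thesis
        by (simp only: nu_pow_left_commute[of "G a c"] eq nu_pow_add_left add_diff_eq)
    qed
    finally show ?thesis
      using ord by (simp add: L_k pair_r L_cr nu_pow_add_left)
  qed
  moreover have "X (e a + e r - edge c) = X (e a - e c)" by (simp add: edge_def c_def r_def)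
  moreover have "G a r = (\<Sum>l = a..<c. X (e a + e r - edge l)) + X (e a + e r - edge c)"
    using ord by (simp add: frieze_entry_def c_def r_def)
  ultimately show ?thesis
    unfolding mutated_variable_def Y_def[symmetric] c_def[symmetric] r_def[symmetric]
      up_def[symmetric] um_def[symmetric]
    by (simp add: add.commute)
qed

lemma fan_cluster_refl: "fan_cluster a a = initial_cluster X"
  by (rule ext) (auto simp: fan_cluster_def)

lemma B_mat_fan_column: "a < n \<Longrightarrow> B_mat n i (a + 1) = fan_column a a i"
  by (auto simp: B_mat_def fan_column_def)

lemma X'_eq: "a < n \<Longrightarrow> X' n \<nu> X (a + 1) = G a (a + 2)"
  unfolding X'_def using mutated_variable_fan[of a a "Lambda_mat n" "B_mat n"] 
    initial_q_commutation B_mat_fan_column fan_cluster_refl by simp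

text \<open>
  The next mutated variable depends only on the column \<open>k + 1\<close> of the exchange matrix, and the
  mutated column \<open>k + 2\<close> only on the columns \<open>k + 1\<close> and \<open>k + 2\<close>. So an invariant for the columns beyond
  \<open>k\<close> suffices; those beyond \<open>k + 1\<close> are still the initial ones. Mutating at \<open>k + 1\<close> adds the positive
  part of the column \<open>k + 1\<close>, at most a single \<open>1\<close> in the row \<open>a\<close>, to the column \<open>k + 2\<close> and changes
  the sign of the row \<open>k + 1\<close>.
\<close>

lemma fan_seed:
  assumes "a \<le> k" "k \<le> n"
  shows "\<exists>B L. quantum_seed n \<nu> X B L (fan_cluster a k) \<and>
    (\<forall>i c. k < c \<longrightarrow> c \<le> n \<longrightarrow> B i c = (if c = k + 1 then fan_column a k i else B_mat n i c))"
  using assms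
proof (induction k rule: dec_induct)
  case base
  have "quantum_seed n \<nu> X (B_mat n) (Lambda_mat n) (fan_cluster a a)"
    unfolding fan_cluster_refl by (rule quantum_seed.initial)
  then show ?case using B_mat_fan_column base by fastforce
next
  case (step k)
  then obtain B L where S: "quantum_seed n \<nu> X B L (fan_cluster a k)"
    and B: "\<And>i c. k < c \<Longrightarrow> c \<le> n \<Longrightarrow> B i c = (if c = k + 1 then fan_column a k i else B_mat n i c)"
    by auto
  have "mutated_variable n \<nu> B L (fan_cluster a k) (k + 1) = G a (k + 2)"
    using step B S by (intro mutated_variable_fan quantum_seed_q_commutation) auto
  then have Y': "fan_cluster a (Suc k) =
      (fan_cluster a k)(Suc k := mutated_variable n \<nu> B L (fan_cluster a k) (Suc k))"
    using step by (auto simp: fan_cluster_def fun_eq_iff)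
  obtain L' where "q_commutation_matrix n \<nu> (fan_cluster a (Suc k)) L'"
    using fan_cluster_q_commutation_matrix step.prems by blast
  then have "quantum_seed n \<nu> X (mutate_matrix B (Suc k)) L' (fan_cluster a (Suc k))"
    using step.prems by (intro quantum_seed.mutation[OF S _ Y']) auto
  moreover have "mutate_matrix B (Suc k) i c =
      (if c = Suc k + 1 then fan_column a (Suc k) i else B_mat n i c)"
    if "Suc k < c" "c \<le> n" for i c
    using that step
    by (auto simp: mutate_matrix_def B fan_column_def B_mat_def)
  ultimately show ?case by blast
qed

lemma frieze_entry_cluster_variable:
  assumes "a + 2 \<le> b" "b \<le> n + 1"
  shows "G a b \<in> quantum_cluster_variables n \<nu> X"
proof -
  from assms obtain c where c: "b = c + 1" "a < c" "c \<le> n" by (cases b) auto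
  then obtain B L where "quantum_seed n \<nu> X B L (fan_cluster a c)"
    using fan_seed[of a c] by fastforce
  moreover have "fan_cluster a c c = G a b" "c \<in> {1..n}"
    using c by (auto simp: fan_cluster_def)
  ultimately show ?thesis
    unfolding quantum_cluster_variables_def by (metis (mono_tags, lifting) mem_Collect_eq)
qed

section \<open>The entries of the frieze\<close>

lemma qP_eq_frieze_entry:
  assumes "a + m \<le> n"
  shows "qP \<nu> (X' n \<nu> X) m (a + 1) = G a (a + m + 1)"
  using assms
proof (induction m rule: induct_nat_012)
  case 0
  then show ?case using frieze_entry_1[of a] by simp
next
  case 1
  then show ?case using X'_eq[of a] by simp
next
  case (ge2 m)
  define b where "b = a + m + 2"
  have W: "X' n \<nu> X b = G (b - 1) (b + 1)" using X'_eq[of "b - 1"] ge2.prems by (simp add: b_def)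
  have "even (b - a) \<longleftrightarrow> even m" by (simp add: b_def)
  with frieze_entry_recursion[of a b] have rec: "G a b * X' n \<nu> X b =
    (if even m then \<nu> * G a (b + 1) + G a (b - 1) else G a (b + 1) + inverse \<nu> * G a (b - 1))"
    using ge2.prems W by (simp add: b_def)
  have "qP \<nu> (X' n \<nu> X) (Suc (Suc m)) (a + 1) =
    (if odd m then G a b * X' n \<nu> X b - inverse \<nu> * G a (b - 1)
     else inverse \<nu> * (G a b * X' n \<nu> X b - G a (b - 1)))"
    using ge2 by (simp add: b_def)
  also have "\<dots> = G a (b + 1)"
    by (simp add: rec nu_nonzero mult.assoc[symmetric])
  finally show ?case by (simp add: b_def)
qed

text \<open>
  The relation at \<open>(i, j)\<close> determines \<open>f (i, j + 1)\<close> from \<open>f (i, j) \<noteq> 0\<close>, \<open>f (i + 1, j)\<close> and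
  \<open>f (i - 1, j + 1)\<close>. The region \<open>i + j \<le> n + 1\<close> is closed under this, which allows an induction on \<open>j\<close>
  and, for fixed \<open>j\<close>, on \<open>i\<close> from the boundary \<open>i = 0\<close>.
\<close>

lemma frieze_of_variables_eq:
  assumes "quantum_frieze_of_variables n \<nu> X f" "i + j \<le> n + 1"
  shows "f (i, int j) = (if j = 0 then X (e i) else G (j - 1) (j + i))"
  using assms(2)
proof (induction j arbitrary: i)
  case 0
  have "e 0 = 0" "e (n + 1) = 0" by (simp_all add: basis_vec_def)
  moreover have "i = 0 \<or> i = n + 1 \<or> i \<in> {1..n}" using 0 by auto
  ultimately show ?case using assms(1)
    by (auto simp: quantum_frieze_of_variables_def quantum_frieze_def initial_cluster_eq X_0)
next
  case (Suc j)
  note IH_j = Suc.IH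
  have bd: "f (0, k) = 1" and
    rel: "i \<in> {1..n} \<Longrightarrow> f (i, k) * f (i, k + 1) - \<nu> * f (i - 1, k + 1) * f (i + 1, k) = 1" for i k
    using assms(1) by (auto simp: quantum_frieze_of_variables_def quantum_frieze_def)
  have "f (i, int (Suc j)) = G j (Suc j + i)"
    using Suc.prems
  proof (induction i)
    case 0
    then show ?case using bd frieze_entry_1[of j] by simp
  next
    case (Suc i)
    define x where "x = f (Suc i, int j)"
    have x: "x = (if j = 0 then X (e (Suc i)) else G (j - 1) (j + Suc i))"
      unfolding x_def using Suc.prems by (intro IH_j) simp
    define y where "y = f (Suc (Suc i), int j)"
    have y: "y = (if j = 0 then X (e (Suc (Suc i))) else G (j - 1) (j + i + 2))"
      using Suc.prems IH_j[of "i + 2"] by (simp add: y_def)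
    have z: "f (i, int (Suc j)) = G j (Suc j + i)" using Suc by simp
    have "x * f (Suc i, int (Suc j)) = 1 + \<nu> * G j (Suc j + i) * y"
      using rel[of "Suc i" "int j"] Suc.prems z by (simp add: x_def y_def algebra_simps)
    also have "\<dots> = x * G j (Suc j + Suc i)"
      using frieze_relation_0[of "Suc i"] frieze_relation[of "j - 1" "j + Suc i"] Suc.prems
      by (cases "j = 0") (auto simp: x y algebra_simps)
    finally have "x * f (Suc i, int (Suc j)) = x * G j (Suc j + Suc i)" .
    moreover have "x \<noteq> 0"
      using Suc.prems frieze_entry_nonzero[of "j - 1" "j + Suc i"]
      by (cases "j = 0") (simp_all add: x X_nonzero)
    ultimately show ?case by simp
  qed
  then show ?case by simp
qed

end

theorem theorem4p1:
  fixes n :: nat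
    and \<nu> :: "'k::division_ring"
    and X :: "(nat \<Rightarrow> int) \<Rightarrow> 'k"
    and f :: "nat \<times> int \<Rightarrow> 'k"
  assumes "even n" and "n > 0"
    and "quantum_torus_fractions n \<nu> X"
    and "quantum_frieze_of_variables n \<nu> X f"
  shows "\<forall>(i, j)\<in>Gamma0 n.
           f (i, j) \<in> quantum_cluster_variables n \<nu> X \<and>
           f (i, j) = (if j = 0 then initial_cluster X i else qP \<nu> (X' n \<nu> X) i (nat j))"
proof (rule ballI, clarify)
  interpret even_quantum_torus n \<nu> X
    using assms by (intro even_quantum_torus.intro even_quantum_torus_axioms.intro)
  fix i :: nat and j :: int
  assume "(i, j) \<in> Gamma0 n"
  then have i: "i \<in> {1..n}" and "0 \<le> j" "int i + j \<le> int n + 1" by (auto simp: Gamma0_def)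
  then obtain m where m: "j = int m" "i + m \<le> n + 1"
    by (metis of_nat_1 of_nat_add of_nat_le_iff zero_le_imp_eq_int)
  note f = frieze_of_variables_eq[OF assms(4) m(2)]
  show "f (i, j) \<in> quantum_cluster_variables n \<nu> X \<and>
      f (i, j) = (if j = 0 then initial_cluster X i else qP \<nu> (X' n \<nu> X) i (nat j))"
  proof (cases "m = 0")
    case True
    have "initial_cluster X i \<in> quantum_cluster_variables n \<nu> X"
      unfolding quantum_cluster_variables_def using quantum_seed.initial i by blast
    then show ?thesis using f i by (simp add: m True initial_cluster_eq)
  next
    case False
    then show ?thesis
      using f m i frieze_entry_cluster_variable[of "m - 1" "m + i"] qP_eq_frieze_entry[of "m - 1" i]
      by (simp add: add.commute)
  qed
qed

end
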